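(* Let $J$ be an ideal of a commutative ring $R$. Then $R/J$ is a flat $R$-module if and only if $\operatorname{Ann}_R(a)+J=R$ for all $a\in J$. *)

theory Defs
  imports "HOL-Algebra.Module" "HOL-Algebra.QuotRing" "HOL-Algebra.Free_Abelian_Groups"
begin

section \<open>Annihilators and the module \<open>R/J\<close>\<close>

definition annihilator :: "('a, 'x) ring_scheme \<Rightarrow> 'a \<Rightarrow> 'a set"
  where "annihilator R a = {r \<in> carrier R. r \<otimes>\<^bsub>R\<^esub> a = \<zero>\<^bsub>R\<^esub>}"

definition quotient_module :: "('a, 'x) ring_scheme \<Rightarrow> 'a set \<Rightarrow> ('a, 'a set) module"
  where "quotient_module R J =
    \<lparr>carrier = carrier (R Quot J), monoid.mult = monoid.mult (R Quot J), one = one (R Quot J),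
     ring.zero = ring.zero (R Quot J), ring.add = ring.add (R Quot J),
     smult = (\<lambda>r X. (J +>\<^bsub>R\<^esub> r) \<otimes>\<^bsub>R Quot J\<^esub> X)\<rparr>"

lemma module_quotient_module:
  assumes "cring R" and "ideal J R"
  shows "module R (quotient_module R J)"
proof -
  interpret cring R by fact
  interpret J: ideal J R by fact
  interpret Q: cring "R Quot J" by (rule J.quotient_is_cring[OF assms(1)])
  interpret h: ring_hom_ring R "R Quot J" "(+>\<^bsub>R\<^esub>) J" by (rule J.rcos_ring_hom_ring)
  show ?thesis
  proof (rule moduleI)
    show "abelian_group (quotient_module R J)"
      by (rule abelian_groupI)
        (use Q.add.l_inv_ex in \<open>auto simp: quotient_module_def Q.a_ac\<close>)
  qed (use Q.m_assoc h.hom_one in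
       \<open>auto simp: quotient_module_def Q.l_distr Q.r_distr assms(1)\<close>)
qed

section \<open>Tensor products\<close>

text \<open>
  The tensor product is presented by generators and relations: the free abelian group on the
  pairs \<open>(m, n)\<close>, modulo the subgroup generated by the relations below.  As \<open>R\<close> is
  commutative, the third family makes \<open>r (m \<otimes> n) = (r m) \<otimes> n = m \<otimes> (r n)\<close> a well-defined scalar
  multiplication.  Flatness only concerns injectivity of maps, so just the underlying abelian
  group (written multiplicatively, like \<^const>\<open>free_Abelian_group\<close>) is constructed.
\<close>

definition tensor_rels ::
    "('a, 'x) ring_scheme \<Rightarrow> ('a, 'm, 'y) module_scheme \<Rightarrow> ('a, 'n, 'z) module_scheme \<Rightarrow>
     (('m \<times> 'n) \<Rightarrow>\<^sub>0 int) set"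
  where "tensor_rels R M N =
      {frag_of (m \<oplus>\<^bsub>M\<^esub> m', n) - frag_of (m, n) - frag_of (m', n) | m m' n.
         m \<in> carrier M \<and> m' \<in> carrier M \<and> n \<in> carrier N}
    \<union> {frag_of (m, n \<oplus>\<^bsub>N\<^esub> n') - frag_of (m, n) - frag_of (m, n') | m n n'.
         m \<in> carrier M \<and> n \<in> carrier N \<and> n' \<in> carrier N}
    \<union> {frag_of (r \<odot>\<^bsub>M\<^esub> m, n) - frag_of (m, r \<odot>\<^bsub>N\<^esub> n) | r m n.
         r \<in> carrier R \<and> m \<in> carrier M \<and> n \<in> carrier N}"

definition tensor_kernel ::
    "('a, 'x) ring_scheme \<Rightarrow> ('a, 'm, 'y) module_scheme \<Rightarrow> ('a, 'n, 'z) module_scheme \<Rightarrow>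
     (('m \<times> 'n) \<Rightarrow>\<^sub>0 int) set"
  where "tensor_kernel R M N =
    generate (free_Abelian_group (carrier M \<times> carrier N)) (tensor_rels R M N)"

definition tensor_product ::
    "('a, 'x) ring_scheme \<Rightarrow> ('a, 'm, 'y) module_scheme \<Rightarrow> ('a, 'n, 'z) module_scheme \<Rightarrow>
     (('m \<times> 'n) \<Rightarrow>\<^sub>0 int) set monoid"
  where "tensor_product R M N =
    free_Abelian_group (carrier M \<times> carrier N) Mod tensor_kernel R M N"

definition mod_hom ::
    "('a, 'x) ring_scheme \<Rightarrow> ('a, 'm, 'y) module_scheme \<Rightarrow> ('a, 'n, 'z) module_scheme \<Rightarrow>
     ('m \<Rightarrow> 'n) set"
  where "mod_hom R M N =
    {f \<in> hom (add_monoid M) (add_monoid N).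
       \<forall>r \<in> carrier R. \<forall>m \<in> carrier M. f (r \<odot>\<^bsub>M\<^esub> m) = r \<odot>\<^bsub>N\<^esub> f m}"

text \<open>
  The map \<open>id \<otimes> f : M \<otimes> N \<rightarrow> M \<otimes> N'\<close>, sending \<open>m \<otimes> n\<close> to \<open>m \<otimes> f n\<close>.  It is written as a union
  over representatives of the coset \<open>X\<close>; all members of the union coincide when \<open>f\<close> is
  \<open>R\<close>-linear (lemma \<open>tensor_map_coset\<close>).
\<close>

definition tensor_map ::
    "('a, 'x) ring_scheme \<Rightarrow> ('a, 'm, 'y) module_scheme \<Rightarrow> ('a, 'n, 'z) module_scheme \<Rightarrow>
     ('a, 'k, 'w) module_scheme \<Rightarrow> ('n \<Rightarrow> 'k) \<Rightarrow>
     (('m \<times> 'n) \<Rightarrow>\<^sub>0 int) set \<Rightarrow> (('m \<times> 'k) \<Rightarrow>\<^sub>0 int) set"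
  where "tensor_map R M N N' f X =
    (\<Union>x \<in> X. tensor_kernel R M N' #>\<^bsub>free_Abelian_group (carrier M \<times> carrier N')\<^esub>
                frag_extend (\<lambda>(m, n). frag_of (m, f n)) x)"

lemma free_Abelian_group_diff_closed:
  assumes "a \<in> carrier (free_Abelian_group S)" and "b \<in> carrier (free_Abelian_group S)"
  shows "a - b \<in> carrier (free_Abelian_group S)"
  using assms keys_diff[of a b] unfolding carrier_free_Abelian_group_iff by blast

lemma tensor_relsI:
  shows "m \<in> carrier M \<Longrightarrow> m' \<in> carrier M \<Longrightarrow> n \<in> carrier N \<Longrightarrow>
      frag_of (m \<oplus>\<^bsub>M\<^esub> m', n) - frag_of (m, n) - frag_of (m', n) \<in> tensor_rels R M N"
    and "m \<in> carrier M \<Longrightarrow> n \<in> carrier N \<Longrightarrow> n' \<in> carrier N \<Longrightarrow>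
      frag_of (m, n \<oplus>\<^bsub>N\<^esub> n') - frag_of (m, n) - frag_of (m, n') \<in> tensor_rels R M N"
    and "r \<in> carrier R \<Longrightarrow> m \<in> carrier M \<Longrightarrow> n \<in> carrier N \<Longrightarrow>
      frag_of (r \<odot>\<^bsub>M\<^esub> m, n) - frag_of (m, r \<odot>\<^bsub>N\<^esub> n) \<in> tensor_rels R M N"
  unfolding tensor_rels_def by blast+

lemma tensor_rels_subset:
  assumes "module R M" and "module R N"
  shows "tensor_rels R M N \<subseteq> carrier (free_Abelian_group (carrier M \<times> carrier N))"
proof -
  interpret M: module R M by fact
  interpret N: module R N by fact
  show ?thesis
    unfolding tensor_rels_def
    by (intro Un_least subsetI; elim CollectE exE conjE; hypsubst; intro free_Abelian_group_diff_closed)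
      (simp_all only: frag_of_in_free_Abelian_group mem_Sigma_iff M.smult_closed N.smult_closed
        M.M.a_closed N.M.a_closed simp_thms)
qed

lemma subgroup_tensor_kernel:
  assumes "module R M" and "module R N"
  shows "subgroup (tensor_kernel R M N) (free_Abelian_group (carrier M \<times> carrier N))"
  unfolding tensor_kernel_def
  by (rule group.generate_is_subgroup[OF group_free_Abelian_group tensor_rels_subset[OF assms]])

lemma group_tensor_product:
  assumes "module R M" and "module R N"
  shows "comm_group (tensor_product R M N)"
  unfolding tensor_product_def
  by (rule comm_group.abelian_FactGroup[OF abelian_free_Abelian_group subgroup_tensor_kernel[OF assms]])

lemma tensor_map_coset:
  assumes M: "module R M" and N: "module R N" and N': "module R N'"
    and f: "f \<in> mod_hom R N N'"
    and x: "x \<in> carrier (free_Abelian_group (carrier M \<times> carrier N))"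
  shows "tensor_map R M N N' f
           (tensor_kernel R M N #>\<^bsub>free_Abelian_group (carrier M \<times> carrier N)\<^esub> x) =
         tensor_kernel R M N' #>\<^bsub>free_Abelian_group (carrier M \<times> carrier N')\<^esub>
           frag_extend (\<lambda>(m, n). frag_of (m, f n)) x"
proof -
  let ?F = "free_Abelian_group (carrier M \<times> carrier N)"
  let ?F' = "free_Abelian_group (carrier M \<times> carrier N')"
  let ?K = "tensor_kernel R M N" and ?K' = "tensor_kernel R M N'"
  let ?g = "frag_extend (\<lambda>(m, n). frag_of (m, f n))"
  interpret M: module R M by fact
  interpret N: module R N by fact
  interpret N': module R N' by fact
  interpret F: group ?F by simp
  interpret F': group ?F' by simp
  interpret K: subgroup ?K ?F by (rule subgroup_tensor_kernel[OF M N])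
  interpret K': subgroup ?K' ?F' by (rule subgroup_tensor_kernel[OF M N'])
  have f_closed: "f n \<in> carrier N'" if "n \<in> carrier N" for n
    using f that by (auto simp: mod_hom_def hom_def)
  have f_add: "f (n \<oplus>\<^bsub>N\<^esub> n') = f n \<oplus>\<^bsub>N'\<^esub> f n'" if "n \<in> carrier N" "n' \<in> carrier N" for n n'
    using f that by (auto simp: mod_hom_def hom_def)
  have f_smult: "f (r \<odot>\<^bsub>N\<^esub> n) = r \<odot>\<^bsub>N'\<^esub> f n" if "r \<in> carrier R" "n \<in> carrier N" for r n
    using f that by (auto simp: mod_hom_def)
  have g_closed: "?g y \<in> carrier ?F'" if "y \<in> carrier ?F" for y
  proof -
    have "Poly_Mapping.keys (case p of (m, n) \<Rightarrow> frag_of (m, f n)) \<subseteq> carrier M \<times> carrier N'"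
      if "p \<in> carrier M \<times> carrier N" for p
      using that f_closed by (cases p) (simp add: keys_frag_of)
    with that show ?thesis
      unfolding carrier_free_Abelian_group_iff by (blast dest: subsetD[OF keys_frag_extend])
  qed
  have frag_map: "?g (frag_of (m, n)) = frag_of (m, f n)" for m n
    by simp
  have g_rel: "?g y \<in> tensor_rels R M N'" if "y \<in> tensor_rels R M N" for y
  proof -
    from \<open>y \<in> tensor_rels R M N\<close> consider
      (l) m m' n where "m \<in> carrier M" "m' \<in> carrier M" "n \<in> carrier N"
            "y = frag_of (m \<oplus>\<^bsub>M\<^esub> m', n) - frag_of (m, n) - frag_of (m', n)"
    | (r) m n n' where "m \<in> carrier M" "n \<in> carrier N" "n' \<in> carrier N"
            "y = frag_of (m, n \<oplus>\<^bsub>N\<^esub> n') - frag_of (m, n) - frag_of (m, n')"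
    | (s) r m n where "r \<in> carrier R" "m \<in> carrier M" "n \<in> carrier N"
            "y = frag_of (r \<odot>\<^bsub>M\<^esub> m, n) - frag_of (m, r \<odot>\<^bsub>N\<^esub> n)"
      unfolding tensor_rels_def by (elim UnE CollectE exE conjE) (rule that; assumption)+
    then show ?thesis
    proof cases
      case l
      then have "?g y = frag_of (m \<oplus>\<^bsub>M\<^esub> m', f n) - frag_of (m, f n) - frag_of (m', f n)"
        by (simp only: frag_map frag_extend_diff)
      with l f_closed show ?thesis by (simp only: tensor_relsI f_closed)
    next
      case r
      then have "?g y = frag_of (m, f n \<oplus>\<^bsub>N'\<^esub> f n') - frag_of (m, f n) - frag_of (m, f n')"
        by (simp only: frag_map frag_extend_diff f_add)
      with r f_closed show ?thesis by (simp only: tensor_relsI f_closed)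
    next
      case s
      then have "?g y = frag_of (r \<odot>\<^bsub>M\<^esub> m, f n) - frag_of (m, r \<odot>\<^bsub>N'\<^esub> f n)"
        by (simp only: frag_map frag_extend_diff f_smult)
      with s f_closed show ?thesis by (simp only: tensor_relsI f_closed)
    qed
  qed
  have g_ker: "?g y \<in> ?K'" if "y \<in> ?K" for y
    using that unfolding tensor_kernel_def
  proof (induction rule: generate.induct)
    case one
    then show ?case using generate.one[of ?F'] by simp
  next
    case (incl h)
    then show ?case by (simp add: generate.incl g_rel)
  next
    case (inv h)
    have h: "h \<in> carrier ?F" "?g h \<in> carrier ?F'"
      using inv tensor_rels_subset[OF M N] g_closed by blast+
    have "?g (inv\<^bsub>?F\<^esub> h) = inv\<^bsub>?F'\<^esub> (?g h)"
      using h by (simp add: frag_extend_minus)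
    with inv show ?case by (metis generate.inv g_rel)
  next
    case (eng h1 h2)
    then show ?case
      using generate.eng[of "?g h1" ?F' "tensor_rels R M N'" "?g h2"]
      by (simp add: frag_extend_add)
  qed
  have "?K' #>\<^bsub>?F'\<^esub> ?g y = ?K' #>\<^bsub>?F'\<^esub> ?g x" if y: "y \<in> ?K #>\<^bsub>?F\<^esub> x" for y
  proof -
    obtain k where k: "k \<in> ?K" "y = k + x"
      using y unfolding r_coset_def by auto
    have "?g y = ?g k \<otimes>\<^bsub>?F'\<^esub> ?g x"
      using k by (simp add: frag_extend_add)
    then have "?g y \<in> ?K' #>\<^bsub>?F'\<^esub> ?g x"
      using g_ker[OF k(1)] unfolding r_coset_def by blast
    then show ?thesis
      using F'.repr_independence[OF _ g_closed[OF x] K'.subgroup_axioms] by blast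
  qed
  moreover have "x \<in> ?K #>\<^bsub>?F\<^esub> x"
    by (rule F.rcos_self[OF x K.subgroup_axioms])
  ultimately show ?thesis
    unfolding tensor_map_def by blast
qed

section \<open>Flatness\<close>

text \<open>
  \<open>M\<close> is flat if \<open>M \<otimes> _\<close> preserves injectivity of \<open>R\<close>-linear maps.  HOL cannot quantify over
  all types inside a definition, so the type \<open>'n\<close> carrying the test modules \<open>N\<close> and \<open>N'\<close> is an
  explicit parameter and plays the role of a universe.
\<close>

definition flat_module ::
    "'n itself \<Rightarrow> ('a, 'x) ring_scheme \<Rightarrow> ('a, 'm, 'y) module_scheme \<Rightarrow> bool"
  where "flat_module (_ :: 'n itself) R M \<longleftrightarrow>
    module R M \<and>
    (\<forall>(N :: ('a, 'n) module) (N' :: ('a, 'n) module) f.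
       module R N \<and> module R N' \<and> f \<in> mod_hom R N N' \<and> inj_on f (carrier N) \<longrightarrow>
       inj_on (tensor_map R M N N' f) (carrier (tensor_product R M N)))"

end

theory Submission
  imports Defs
begin

text \<open>
  The tensor product \<open>R/J \<otimes> N\<close> is \<open>N/JN\<close>: each of its elements has the form \<open>1 \<otimes> n\<close>
  (lemma \<open>tensor_eq_unit_tensor\<close>), elements \<open>j n\<close> with \<open>j \<in> J\<close> contribute nothing
  (\<open>unit_tensor_add_smult\<close>), and nothing outside \<open>JN\<close> is killed (\<open>unit_tensor_eqD\<close>).  So
  flatness says that \<open>f n \<in> JN'\<close> forces \<open>n \<in> JN\<close> for every injective linear \<open>f : N \<rightarrow> N'\<close>.

  If \<open>R/J\<close> is flat and \<open>a \<in> J\<close>, apply this to the inclusion \<open>aR \<subseteq> R\<close>.  The element \<open>a\<close> lies in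
  \<open>JR = J\<close>, so it lies in \<open>J(aR)\<close>, that is, \<open>a = ja\<close> for some \<open>j \<in> J\<close>; then \<open>1 - j\<close>
  annihilates \<open>a\<close>, and \<open>1 = (1 - j) + j\<close>.

  Conversely, splitting \<open>1\<close> along \<open>Ann(a) + J = R\<close> yields for each \<open>a \<in> J\<close> an \<open>e \<in> J\<close> with
  \<open>ea = a\<close>.  The elements of a module that are fixed by some element of \<open>J\<close> then form a subgroup
  containing all \<open>j n\<close>, hence containing \<open>JN'\<close>.  If \<open>f n \<in> JN'\<close>, then
  \<open>f n = e (f n) = f (e n)\<close> for some \<open>e \<in> J\<close>, so \<open>n = e n \<in> JN\<close> by injectivity.
\<close>

section \<open>The tensor product of a cyclic module with a module\<close>

text \<open>The element \<open>1 \<otimes> n\<close> of \<open>R/J \<otimes> N\<close>.\<close>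

definition unit_tensor ::
    "('a, 'x) ring_scheme \<Rightarrow> 'a set \<Rightarrow> ('a, 'n, 'z) module_scheme \<Rightarrow> 'n \<Rightarrow> (('a set \<times> 'n) \<Rightarrow>\<^sub>0 int) set"
  where "unit_tensor R J N n =
    tensor_kernel R (quotient_module R J) N
      #>\<^bsub>free_Abelian_group (carrier (quotient_module R J) \<times> carrier N)\<^esub>
    frag_of (J +>\<^bsub>R\<^esub> \<one>\<^bsub>R\<^esub>, n)"

locale module_with_ideal = module R N + J: ideal J R
  for R and N (structure) and J
begin

abbreviation "Q \<equiv> quotient_module R J"
abbreviation "F \<equiv> free_Abelian_group (carrier Q \<times> carrier N)"
abbreviation "K \<equiv> tensor_kernel R Q N"
abbreviation "U \<equiv> J +>\<^bsub>R\<^esub> \<one>\<^bsub>R\<^esub>"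

lemma module_N: "module R N"
  by unfold_locales

lemma module_Q: "module R Q"
  by (rule module_quotient_module[OF R.cring_axioms J.ideal_axioms])

lemma carrier_Q: "carrier Q = (\<lambda>r. J +>\<^bsub>R\<^esub> r) ` carrier R"
  by (auto simp: quotient_module_def FactRing_def A_RCOSETS_def')

lemma smult_Q: "r \<in> carrier R \<Longrightarrow> s \<in> carrier R \<Longrightarrow> r \<odot>\<^bsub>Q\<^esub> (J +>\<^bsub>R\<^esub> s) = J +>\<^bsub>R\<^esub> (r \<otimes>\<^bsub>R\<^esub> s)"
  by (simp add: quotient_module_def FactRing_def J.rcoset_mult_add)

lemma add_Q:
  "r \<in> carrier R \<Longrightarrow> s \<in> carrier R \<Longrightarrow> (J +>\<^bsub>R\<^esub> r) \<oplus>\<^bsub>Q\<^esub> (J +>\<^bsub>R\<^esub> s) = J +>\<^bsub>R\<^esub> (r \<oplus>\<^bsub>R\<^esub> s)"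
  by (simp add: quotient_module_def FactRing_def J.a_rcos_sum)

lemma U_closed: "U \<in> carrier Q"
  by (auto simp: carrier_Q)

lemma subgroup_K: "subgroup K F"
  by (rule subgroup_tensor_kernel[OF module_Q module_N])

lemma K_add: "x \<in> K \<Longrightarrow> y \<in> K \<Longrightarrow> x + y \<in> K"
  using subgroup.m_closed[OF subgroup_K] by simp

lemma K_uminus: "x \<in> K \<Longrightarrow> - x \<in> K"
  using subgroup.m_inv_closed[OF subgroup_K, of x] subgroup.mem_carrier[OF subgroup_K, of x] by simp

lemma K_diff: "x \<in> K \<Longrightarrow> y \<in> K \<Longrightarrow> x - y \<in> K"
  using K_add[of x "- y"] K_uminus[of y] by simp

lemma coset_K_eq_iff:
  assumes "x \<in> carrier F" and "y \<in> carrier F"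
  shows "K #>\<^bsub>F\<^esub> x = K #>\<^bsub>F\<^esub> y \<longleftrightarrow> x - y \<in> K"
proof -
  have "x \<in> K #>\<^bsub>F\<^esub> y \<longleftrightarrow> x - y \<in> K"
    using subgroup.rcos_module[OF subgroup_K group_free_Abelian_group assms(2) assms(1)] assms
    by simp
  moreover have "x \<in> K #>\<^bsub>F\<^esub> y \<longleftrightarrow> K #>\<^bsub>F\<^esub> x = K #>\<^bsub>F\<^esub> y"
    using group.repr_independence[OF group_free_Abelian_group _ assms(2) subgroup_K]
      group.rcos_self[OF group_free_Abelian_group assms(1) subgroup_K] by blast
  ultimately show ?thesis by simp
qed

lemma tensor_relation_in_K: "x \<in> tensor_rels R Q N \<Longrightarrow> x \<in> K"
  unfolding tensor_kernel_def by (rule generate.incl)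

lemma move_scalar:
  assumes "r \<in> carrier R" and "n \<in> carrier N"
  shows "frag_of (J +>\<^bsub>R\<^esub> r, n) - frag_of (U, r \<odot> n) \<in> K"
  using tensor_relation_in_K[OF tensor_relsI(3)[OF assms(1) U_closed assms(2)]] assms
  by (simp add: smult_Q)

lemma unit_tensor_additive:
  assumes "n \<in> carrier N" and "m \<in> carrier N"
  shows "frag_of (U, n \<oplus> m) - frag_of (U, n) - frag_of (U, m) \<in> K"
  by (rule tensor_relation_in_K[OF tensor_relsI(2)[OF U_closed assms]])

lemma unit_tensor_zero: "frag_of (U, \<zero>) \<in> K"
  using K_uminus[OF unit_tensor_additive[OF M.zero_closed M.zero_closed]] by simp

lemma unit_tensor_smult:
  assumes j: "j \<in> J" and m: "m \<in> carrier N"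
  shows "frag_of (U, j \<odot> m) \<in> K"
proof -
  have eq: "J +>\<^bsub>R\<^esub> j = J +>\<^bsub>R\<^esub> \<zero>\<^bsub>R\<^esub>"
    using j J.a_rcos_const J.a_rcos_const[OF J.zero_closed] by simp
  have "frag_of (U, j \<odot> m) = frag_of (U, \<zero>)
      + (frag_of (J +>\<^bsub>R\<^esub> \<zero>\<^bsub>R\<^esub>, m) - frag_of (U, \<zero>\<^bsub>R\<^esub> \<odot> m))
      - (frag_of (J +>\<^bsub>R\<^esub> j, m) - frag_of (U, j \<odot> m))"
    using m by (simp add: eq)
  then show ?thesis
    using K_diff[OF K_add[OF unit_tensor_zero move_scalar[OF R.zero_closed m]]
        move_scalar[OF J.Icarr[OF j] m]] by simp
qed

lemma unit_tensor_add_smult: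
  assumes n: "n \<in> carrier N" and j: "j \<in> J" and m: "m \<in> carrier N"
  shows "unit_tensor R J N (n \<oplus> j \<odot> m) = unit_tensor R J N n"
proof -
  have jm: "j \<odot> m \<in> carrier N"
    using j m J.Icarr by simp
  have "frag_of (U, n \<oplus> j \<odot> m) - frag_of (U, n) \<in> K"
    using K_add[OF unit_tensor_additive[OF n jm] unit_tensor_smult[OF j m]] by simp
  then show ?thesis
    unfolding unit_tensor_def
    by (subst coset_K_eq_iff) (simp_all only: frag_of_in_free_Abelian_group mem_Sigma_iff
        U_closed n jm M.a_closed simp_thms)
qed

text \<open>
  Since \<open>(J + r) \<otimes> n = 1 \<otimes> r n\<close>, every generator is a unit tensor, and unit tensors are closed
  under differences.
\<close>

lemma tensor_eq_unit_tensor: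
  assumes "X \<in> carrier (tensor_product R Q N)"
  obtains n where "n \<in> carrier N" and "X = unit_tensor R J N n"
proof -
  obtain x where x: "x \<in> carrier F" and X: "X = K #>\<^bsub>F\<^esub> x"
    using assms by (auto simp: tensor_product_def FactGroup_def RCOSETS_def)
  have "Poly_Mapping.keys x \<subseteq> carrier Q \<times> carrier N"
    using x by simp
  then have "\<exists>n \<in> carrier N. x - frag_of (U, n) \<in> K"
  proof (induction rule: frag_induction)
    case zero
    show ?case
      using K_uminus[OF unit_tensor_zero] by (intro bexI[of _ \<zero>]) simp_all
  next
    case (one p)
    then obtain r n where "r \<in> carrier R" "n \<in> carrier N" "p = (J +>\<^bsub>R\<^esub> r, n)"
      by (auto simp: carrier_Q)
    then show ?case
      using move_scalar by (intro bexI[of _ "r \<odot> n"]) simp_all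
  next
    case (diff a b)
    then obtain n m where n: "n \<in> carrier N" "a - frag_of (U, n) \<in> K"
      and m: "m \<in> carrier N" "b - frag_of (U, m) \<in> K"
      by blast
    have "(n \<ominus> m) \<oplus> m = n"
      using n m by (simp add: M.minus_eq M.a_assoc M.l_neg)
    then have "frag_of (U, n) - frag_of (U, n \<ominus> m) - frag_of (U, m) \<in> K"
      using unit_tensor_additive[of "n \<ominus> m" m] n m by simp
    from K_add[OF K_diff[OF n(2) m(2)] this] show ?case
      using n m by (intro bexI[of _ "n \<ominus> m"]) (simp_all add: algebra_simps)
  qed
  then obtain n where n: "n \<in> carrier N" "x - frag_of (U, n) \<in> K"
    by blast
  then have "X = unit_tensor R J N n"
    unfolding unit_tensor_def X
    by (subst coset_K_eq_iff[OF x]) (simp_all only: frag_of_in_free_Abelian_group mem_Sigma_iff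
        U_closed simp_thms)
  with n(1) show ?thesis
    by (rule that)
qed

text \<open>
  The assignment \<open>(J + r) \<otimes> n \<mapsto> r n\<close> is well defined only modulo \<open>D\<close>.  Instead of passing to
  the quotient \<open>N/D\<close>, choose a representative of each coset; this defines a homomorphism into
  \<open>N\<close> on the free abelian group, and it maps each relation, hence all of \<open>K\<close>, into \<open>D\<close>.
\<close>

lemma unit_tensor_eqD:
  assumes D: "subgroup D (add_monoid N)"
    and JD: "\<And>j n. j \<in> J \<Longrightarrow> n \<in> carrier N \<Longrightarrow> j \<odot> n \<in> D"
    and n: "n \<in> carrier N" and m: "m \<in> carrier N"
    and eq: "unit_tensor R J N n = unit_tensor R J N m"
  shows "n \<ominus> m \<in> D"
proof -
  interpret D: subgroup D "add_monoid N" by (rule D)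
  have D_carr: "x \<in> carrier N" if "x \<in> D" for x
    using D.subset that by auto
  have D_add: "x \<oplus> y \<in> D" if "x \<in> D" "y \<in> D" for x y
    using D.m_closed[OF that] by simp
  have D_minus: "\<ominus> x \<in> D" if "x \<in> D" for x
    using D.m_inv_closed[OF that] by (simp add: a_inv_def)
  define rep where "rep X = (SOME r. r \<in> carrier R \<and> X = J +>\<^bsub>R\<^esub> r)" for X
  have rep: "rep X \<in> carrier R" "X = J +>\<^bsub>R\<^esub> rep X" if "X \<in> carrier Q" for X
    using that someI_ex[of "\<lambda>r. r \<in> carrier R \<and> X = J +>\<^bsub>R\<^esub> r"]
    unfolding rep_def carrier_Q by blast+
  have rep_coset: "rep (J +>\<^bsub>R\<^esub> r) \<ominus>\<^bsub>R\<^esub> r \<in> J" if r: "r \<in> carrier R" for r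
  proof -
    have "J +>\<^bsub>R\<^esub> r \<in> carrier Q"
      using r by (auto simp: carrier_Q)
    note * = rep[OF this]
    have "rep (J +>\<^bsub>R\<^esub> r) \<in> J +>\<^bsub>R\<^esub> r"
      using J.a_rcos_self[OF *(1)] *(2) by simp
    then show ?thesis
      using J.a_rcos_module_minus[OF R.ring_axioms r *(1)] by simp
  qed
  \<comment> \<open>Changing a scalar by an element of \<open>J\<close> changes the product by an element of \<open>D\<close>.\<close>
  have change: "r \<odot> x \<ominus> s \<odot> x \<in> D"
    if "r \<in> carrier R" "s \<in> carrier R" "x \<in> carrier N" "r \<ominus>\<^bsub>R\<^esub> s \<in> J" for r s x
    using JD[OF that(4,3)] that
    by (simp add: R.minus_eq M.minus_eq smult_l_distr smult_l_minus)
  have gens: "(\<lambda>(X, n). rep X \<odot> n) ` (carrier Q \<times> carrier N) \<subseteq> carrier (add_monoid N)"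
    using rep(1) by auto
  obtain h where h: "h \<in> hom F (add_monoid N)"
    and h_gen: "\<And>p. p \<in> carrier Q \<times> carrier N \<Longrightarrow> h (frag_of p) = (\<lambda>(X, n). rep X \<odot> n) p"
    by (rule comm_group.free_Abelian_group_universal[OF M.a_comm_group gens]) blast
  interpret h: group_hom F "add_monoid N" h
    using h M.a_group by (simp add: group_hom_def group_hom_axioms_def)
  have h_closed: "h x \<in> carrier N" if "x \<in> carrier F" for x
    using h.hom_closed[OF that] by simp
  have h_diff: "h (x - y) = h x \<ominus> h y" if x: "x \<in> carrier F" and y: "y \<in> carrier F" for x y
  proof -
    have "h (x \<otimes>\<^bsub>F\<^esub> inv\<^bsub>F\<^esub> y) = h x \<ominus> h y"
      using h.hom_mult[OF x h.G.inv_closed[OF y]] h.hom_inv[OF y]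
      by (simp add: M.minus_eq a_inv_def)
    then show ?thesis
      using y by simp
  qed
  have h_frag: "h (frag_of (X, n)) = rep X \<odot> n" if "X \<in> carrier Q" "n \<in> carrier N" for X n
    using h_gen[of "(X, n)"] that by simp
  interpret Q: module R Q by (rule module_Q)
  have h_rel: "h y \<in> D" if "y \<in> tensor_rels R Q N" for y
  proof -
    from that consider
      (l) X X' n where "X \<in> carrier Q" "X' \<in> carrier Q" "n \<in> carrier N"
            "y = frag_of (X \<oplus>\<^bsub>Q\<^esub> X', n) - frag_of (X, n) - frag_of (X', n)"
    | (r) X n n' where "X \<in> carrier Q" "n \<in> carrier N" "n' \<in> carrier N"
            "y = frag_of (X, n \<oplus> n') - frag_of (X, n) - frag_of (X, n')"
    | (s) r X n where "r \<in> carrier R" "X \<in> carrier Q" "n \<in> carrier N"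
            "y = frag_of (r \<odot>\<^bsub>Q\<^esub> X, n) - frag_of (X, r \<odot> n)"
      unfolding tensor_rels_def by (elim UnE CollectE exE conjE) (rule that; assumption)+
    then show ?thesis
    proof cases
      case l
      note c = rep[OF l(1)] rep[OF l(2)]
      have sum: "X \<oplus>\<^bsub>Q\<^esub> X' = J +>\<^bsub>R\<^esub> (rep X \<oplus>\<^bsub>R\<^esub> rep X')"
        using add_Q[OF c(1) c(3)] c by simp
      have "h y = rep (X \<oplus>\<^bsub>Q\<^esub> X') \<odot> n \<ominus> rep X \<odot> n \<ominus> rep X' \<odot> n"
        unfolding l(4)
        by (simp only: h_diff h_frag l frag_of_in_free_Abelian_group mem_Sigma_iff Q.M.a_closed
            free_Abelian_group_diff_closed simp_thms)
      also have "\<dots> = rep (X \<oplus>\<^bsub>Q\<^esub> X') \<odot> n \<ominus> (rep X \<oplus>\<^bsub>R\<^esub> rep X') \<odot> n"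
        using c l(3) rep(1)[OF Q.M.a_closed[OF l(1,2)]]
        by (simp add: M.minus_eq smult_l_distr M.minus_add M.a_assoc)
      also have "\<dots> \<in> D"
        using change[OF _ _ l(3) rep_coset[of "rep X \<oplus>\<^bsub>R\<^esub> rep X'"]] c
          rep(1)[OF Q.M.a_closed[OF l(1,2)]] unfolding sum by simp
      finally show ?thesis .
    next
      case r
      have "h y = rep X \<odot> (n \<oplus> n') \<ominus> rep X \<odot> n \<ominus> rep X \<odot> n'"
        unfolding r(4)
        by (simp only: h_diff h_frag r frag_of_in_free_Abelian_group mem_Sigma_iff M.a_closed
            free_Abelian_group_diff_closed simp_thms)
      also have "\<dots> = (rep X \<odot> n \<oplus> rep X \<odot> n') \<ominus> (rep X \<odot> n \<oplus> rep X \<odot> n')"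
        using rep(1)[OF r(1)] r by (simp add: M.minus_eq smult_r_distr M.minus_add M.a_assoc)
      also have "\<dots> = \<zero>"
        using rep(1)[OF r(1)] r by (simp add: M.minus_eq M.r_neg)
      finally show ?thesis
        using D.one_closed by simp
    next
      case s
      note c = rep[OF s(2)]
      have prod: "r \<odot>\<^bsub>Q\<^esub> X = J +>\<^bsub>R\<^esub> (r \<otimes>\<^bsub>R\<^esub> rep X)"
        using smult_Q[OF s(1) c(1)] c by simp
      have "h y = rep (r \<odot>\<^bsub>Q\<^esub> X) \<odot> n \<ominus> rep X \<odot> (r \<odot> n)"
        unfolding s(4)
        by (simp only: h_diff h_frag s frag_of_in_free_Abelian_group mem_Sigma_iff smult_closed
            Q.smult_closed simp_thms)
      also have "\<dots> = rep (r \<odot>\<^bsub>Q\<^esub> X) \<odot> n \<ominus> (r \<otimes>\<^bsub>R\<^esub> rep X) \<odot> n"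
        using c s by (simp add: smult_assoc1[symmetric] R.m_comm)
      also have "\<dots> \<in> D"
        using change[OF _ _ s(3) rep_coset[of "r \<otimes>\<^bsub>R\<^esub> rep X"]] c s(1)
          rep(1)[OF Q.smult_closed[OF s(1,2)]] unfolding prod by simp
      finally show ?thesis .
    qed
  qed
  have h_K: "h y \<in> D" if "y \<in> K" for y
    using that unfolding tensor_kernel_def
  proof (induction rule: generate.induct)
    case one
    then show ?case using h.hom_one D.one_closed by simp
  next
    case (incl y)
    then show ?case by (rule h_rel)
  next
    case (inv y)
    then have "y \<in> carrier F"
      using tensor_rels_subset[OF module_Q module_N] by blast
    then show ?case
      using D_minus[OF h_rel[OF inv]] h.hom_inv by (simp add: a_inv_def)
  next
    case (eng y z)
    then have "y \<in> carrier F" "z \<in> carrier F"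
      using h.G.generate_in_carrier[OF tensor_rels_subset[OF module_Q module_N]] by blast+
    then show ?case
      using D_add[OF eng.IH] h.hom_mult by simp
  qed
  have c: "frag_of (U, n) \<in> carrier F" "frag_of (U, m) \<in> carrier F"
    using n m U_closed by simp_all
  have "h (frag_of (U, n) - frag_of (U, m)) \<in> D"
    using eq coset_K_eq_iff[OF c] h_K unfolding unit_tensor_def by simp
  then have u: "rep U \<odot> n \<ominus> rep U \<odot> m \<in> D"
    using h_diff[OF c] h_frag[OF U_closed] n m by simp
  have rU: "rep U \<in> carrier R"
    by (rule rep(1)[OF U_closed])
  have nm: "n \<ominus> m \<in> carrier N"
    using n m by simp
  have u': "rep U \<odot> (n \<ominus> m) \<in> D"
    using u rU n m by (simp add: M.minus_eq smult_r_distr smult_r_minus)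
  \<comment> \<open>\<open>rep U\<close> is only known to lie in \<open>1 + J\<close>; modulo \<open>D\<close> it acts as \<open>1\<close>.\<close>
  have d: "rep U \<odot> (n \<ominus> m) \<ominus> (n \<ominus> m) \<in> D"
    using change[OF rU R.one_closed nm rep_coset[OF R.one_closed]] nm by simp
  have "n \<ominus> m = rep U \<odot> (n \<ominus> m) \<oplus> \<ominus> (rep U \<odot> (n \<ominus> m) \<ominus> (n \<ominus> m))"
    using rU nm by (simp add: M.minus_eq M.minus_add M.r_neg M.a_assoc[symmetric])
  then show ?thesis
    using D_add[OF u' D_minus[OF d]] by simp
qed

end

lemma tensor_map_unit_tensor:
  assumes N: "module_with_ideal R N J" and N': "module R N'"
    and f: "f \<in> mod_hom R N N'" and n: "n \<in> carrier N"
  shows "tensor_map R (quotient_module R J) N N' f (unit_tensor R J N n) = unit_tensor R J N' (f n)"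
proof -
  interpret module_with_ideal R N J by (rule N)
  show ?thesis
    unfolding unit_tensor_def
    by (subst tensor_map_coset[OF module_Q module_N N' f]) (use n U_closed in simp_all)
qed

section \<open>Ideals as modules over a prescribed type\<close>

text \<open>
  Flatness tests only modules whose elements have a fixed type, so an ideal \<open>I\<close> is copied there
  along a map \<open>\<phi>\<close> that is injective on \<open>R\<close>.  Decoding always uses the inverse of \<open>\<phi>\<close> on all of
  \<open>R\<close>, which makes the copy of a smaller ideal a literal restriction of the copy of a larger one.
\<close>

definition ideal_copy :: "('a \<Rightarrow> 'n) \<Rightarrow> ('a, 'x) ring_scheme \<Rightarrow> 'a set \<Rightarrow> ('a, 'n) module"
  where "ideal_copy \<phi> R I =
    \<lparr>carrier = \<phi> ` I, monoid.mult = undefined, one = undefined, ring.zero = \<phi> \<zero>\<^bsub>R\<^esub>,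
     ring.add = (\<lambda>x y. \<phi> (inv_into (carrier R) \<phi> x \<oplus>\<^bsub>R\<^esub> inv_into (carrier R) \<phi> y)),
     smult = (\<lambda>r x. \<phi> (r \<otimes>\<^bsub>R\<^esub> inv_into (carrier R) \<phi> x))\<rparr>"

lemma ideal_copy_simps:
  assumes "inj_on \<phi> (carrier R)"
  shows "carrier (ideal_copy \<phi> R I) = \<phi> ` I"
    and "\<zero>\<^bsub>ideal_copy \<phi> R I\<^esub> = \<phi> \<zero>\<^bsub>R\<^esub>"
    and "x \<in> carrier R \<Longrightarrow> y \<in> carrier R \<Longrightarrow> \<phi> x \<oplus>\<^bsub>ideal_copy \<phi> R I\<^esub> \<phi> y = \<phi> (x \<oplus>\<^bsub>R\<^esub> y)"
    and "x \<in> carrier R \<Longrightarrow> r \<odot>\<^bsub>ideal_copy \<phi> R I\<^esub> \<phi> x = \<phi> (r \<otimes>\<^bsub>R\<^esub> x)"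
  using assms by (simp_all add: ideal_copy_def)

lemma module_ideal_copy:
  assumes "cring R" and "ideal I R" and inj: "inj_on \<phi> (carrier R)"
  shows "module R (ideal_copy \<phi> R I)"
proof -
  interpret cring R by fact
  interpret I: ideal I R by fact
  note simps = ideal_copy_simps[OF inj]
  show ?thesis
  proof (rule moduleI)
    show "abelian_group (ideal_copy \<phi> R I)"
    proof (rule abelian_groupI)
      fix x assume "x \<in> carrier (ideal_copy \<phi> R I)"
      then obtain i where "i \<in> I" "x = \<phi> i"
        by (auto simp: simps)
      then show "\<exists>y \<in> carrier (ideal_copy \<phi> R I). y \<oplus>\<^bsub>ideal_copy \<phi> R I\<^esub> x = \<zero>\<^bsub>ideal_copy \<phi> R I\<^esub>"
        using I.a_inv_closed[of i] by (auto simp: simps I.Icarr l_neg intro!: bexI[of _ "\<ominus>\<^bsub>R\<^esub> i"])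
    qed (auto simp: simps I.Icarr I.a_closed I.zero_closed a_ac)
  qed (auto simp: simps I.Icarr I.a_closed I.I_l_closed l_distr r_distr m_assoc assms(1))
qed

section \<open>Flatness of a cyclic module\<close>

text \<open>
  The inclusion \<open>aR \<subseteq> R\<close> identifies \<open>1 \<otimes> a\<close> with \<open>1 \<otimes> 0\<close> after tensoring, because
  \<open>a = a 1\<close> with \<open>a \<in> J\<close>; flatness pulls the identity back to \<open>R/J \<otimes> aR\<close>, where it
  says that \<open>a\<close> lies in \<open>J(aR) = Ja\<close>.
\<close>

lemma flat_quotient_imp_fixed:
  fixes R :: "('a, 'x) ring_scheme" and \<phi> :: "'a \<Rightarrow> 'n"
  assumes "cring R" and "ideal J R" and inj: "inj_on \<phi> (carrier R)"
    and flat: "flat_module TYPE('n) R (quotient_module R J)"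
    and a: "a \<in> J"
  obtains e where "e \<in> J" and "e \<otimes>\<^bsub>R\<^esub> a = a"
proof -
  interpret cring R by fact
  interpret J: ideal J R by fact
  have aR: "a \<in> carrier R"
    using a by (rule J.Icarr)
  interpret P: ideal "PIdl\<^bsub>R\<^esub> a" R
    by (rule cgenideal_ideal[OF aR])
  define N N' where "N = ideal_copy \<phi> R (PIdl\<^bsub>R\<^esub> a)" and "N' = ideal_copy \<phi> R (carrier R)"
  have mN: "module R N" and mN': "module R N'"
    unfolding N_def N'_def
    by (rule module_ideal_copy[OF assms(1) _ inj], rule P.ideal_axioms oneideal)+
  interpret N: module_with_ideal R N J
    by (rule module_with_ideal.intro[OF mN assms(2)])
  interpret N': module_with_ideal R N' J
    by (rule module_with_ideal.intro[OF mN' assms(2)])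
  note sN = ideal_copy_simps[OF inj, where I = "PIdl\<^bsub>R\<^esub> a", folded N_def]
  note sN' = ideal_copy_simps[OF inj, where I = "carrier R", folded N'_def]
  have id: "(\<lambda>x. x) \<in> mod_hom R N N'"
    unfolding mod_hom_def hom_def by (auto simp: sN sN' P.Icarr)
  let ?T = "tensor_map R (quotient_module R J) N N' (\<lambda>x. x)"
  have "inj_on ?T (carrier (tensor_product R (quotient_module R J) N))"
    using flat mN mN' id unfolding flat_module_def by (metis inj_on_id2)
  moreover have aP: "a \<in> PIdl\<^bsub>R\<^esub> a"
    by (rule cgenideal_self[OF aR])
  then have a_N: "\<phi> a \<in> carrier N" and zero_N: "\<phi> \<zero>\<^bsub>R\<^esub> \<in> carrier N"
    by (auto simp: sN P.zero_closed)
  have unit_closed: "unit_tensor R J N x \<in> carrier (tensor_product R (quotient_module R J) N)"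
    if "x \<in> carrier N" for x
    using that N.U_closed unfolding tensor_product_def unit_tensor_def FactGroup_def RCOSETS_def
    by auto
  have "unit_tensor R J N' (\<phi> a) = unit_tensor R J N' (\<phi> \<zero>\<^bsub>R\<^esub>)"
    using N'.unit_tensor_add_smult[of "\<phi> \<zero>\<^bsub>R\<^esub>" a "\<phi> \<one>\<^bsub>R\<^esub>"] a aR by (simp add: sN')
  then have "?T (unit_tensor R J N (\<phi> a)) = ?T (unit_tensor R J N (\<phi> \<zero>\<^bsub>R\<^esub>))"
    using tensor_map_unit_tensor[OF N.module_with_ideal_axioms mN' id] a_N zero_N by simp
  ultimately have eq: "unit_tensor R J N (\<phi> a) = unit_tensor R J N (\<phi> \<zero>\<^bsub>R\<^esub>)"
    using unit_closed a_N zero_N by (meson inj_onD)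
  \<comment> \<open>The products of elements of \<open>J\<close> with elements of \<open>aR\<close> are exactly the multiples \<open>j a\<close>.\<close>
  define D where "D = (\<lambda>j. \<phi> (j \<otimes>\<^bsub>R\<^esub> a)) ` J"
  have D_sub: "D \<subseteq> carrier N"
    using P.I_l_closed[OF aP] J.Icarr by (auto simp: D_def sN)
  have D: "subgroup D (add_monoid N)"
  proof (rule group.subgroupI[OF N.M.a_group])
    show "D \<subseteq> carrier (add_monoid N)"
      using D_sub by simp
    show "D \<noteq> {}"
      using a by (auto simp: D_def)
  next
    fix x assume "x \<in> D"
    then obtain j where j: "j \<in> J" "x = \<phi> (j \<otimes>\<^bsub>R\<^esub> a)"
      by (auto simp: D_def)
    have "\<phi> ((\<ominus>\<^bsub>R\<^esub> j) \<otimes>\<^bsub>R\<^esub> a) \<oplus>\<^bsub>N\<^esub> x = \<zero>\<^bsub>N\<^esub>"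
      using j aR by (simp add: sN J.Icarr l_minus l_neg)
    moreover have m: "\<phi> ((\<ominus>\<^bsub>R\<^esub> j) \<otimes>\<^bsub>R\<^esub> a) \<in> D"
      using j by (simp add: D_def)
    ultimately have "\<ominus>\<^bsub>N\<^esub> x = \<phi> ((\<ominus>\<^bsub>R\<^esub> j) \<otimes>\<^bsub>R\<^esub> a)"
      using D_sub \<open>x \<in> D\<close> by (intro N.M.minus_equality) auto
    with m show "inv\<^bsub>add_monoid N\<^esub> x \<in> D"
      by (simp add: a_inv_def)
  next
    fix x y assume "x \<in> D" "y \<in> D"
    then obtain i j where "i \<in> J" "x = \<phi> (i \<otimes>\<^bsub>R\<^esub> a)" "j \<in> J" "y = \<phi> (j \<otimes>\<^bsub>R\<^esub> a)"
      by (auto simp: D_def)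
    then show "x \<otimes>\<^bsub>add_monoid N\<^esub> y \<in> D"
      using aR by (auto simp: D_def sN J.Icarr l_distr[symmetric])
  qed
  have "\<phi> a \<ominus>\<^bsub>N\<^esub> \<phi> \<zero>\<^bsub>R\<^esub> \<in> D"
  proof (rule N.unit_tensor_eqD[OF D _ a_N zero_N eq])
    fix j n assume j: "j \<in> J" and "n \<in> carrier N"
    then obtain r where r: "r \<in> carrier R" "n = \<phi> (r \<otimes>\<^bsub>R\<^esub> a)"
      unfolding sN(1) cgenideal_def by blast
    then have "j \<odot>\<^bsub>N\<^esub> n = \<phi> ((j \<otimes>\<^bsub>R\<^esub> r) \<otimes>\<^bsub>R\<^esub> a)"
      using j aR by (simp add: sN J.Icarr m_assoc)
    then show "j \<odot>\<^bsub>N\<^esub> n \<in> D"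
      using J.I_r_closed[OF j r(1)] by (simp add: D_def)
  qed
  then have "\<phi> a \<in> D"
    using a_N by (simp add: sN(2)[symmetric] N.M.minus_eq N.M.minus_equality[of "\<zero>\<^bsub>N\<^esub>" "\<zero>\<^bsub>N\<^esub>"])
  then obtain j where j: "j \<in> J" "\<phi> a = \<phi> (j \<otimes>\<^bsub>R\<^esub> a)"
    by (auto simp: D_def)
  then have "j \<otimes>\<^bsub>R\<^esub> a = a"
    using inj_onD[OF inj, of "j \<otimes>\<^bsub>R\<^esub> a" a] aR J.Icarr by simp
  with j(1) show ?thesis
    by (rule that)
qed

text \<open>
  If \<open>e\<close> fixes \<open>x\<close> and \<open>e'\<close> fixes \<open>y\<close>, then \<open>e + e' - e e'\<close> fixes both, because
  \<open>1 - (e + e' - e e') = (1 - e) (1 - e')\<close>.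
\<close>

lemma (in module_with_ideal) subgroup_fixed_elements:
  "subgroup {x \<in> carrier N. \<exists>e \<in> J. e \<odot> x = x} (add_monoid N)"
proof (rule group.subgroupI[OF M.a_group])
  show "{x \<in> carrier N. \<exists>e \<in> J. e \<odot> x = x} \<noteq> {}"
    using J.zero_closed by (auto intro!: exI[of _ \<zero>] bexI[of _ "\<zero>\<^bsub>R\<^esub>"])
next
  fix x assume "x \<in> {x \<in> carrier N. \<exists>e \<in> J. e \<odot> x = x}"
  then obtain e where "x \<in> carrier N" "e \<in> J" "e \<odot> x = x"
    by blast
  moreover from this have "e \<odot> (\<ominus> x) = \<ominus> x"
    by (simp add: smult_r_minus J.Icarr)
  ultimately show "inv\<^bsub>add_monoid N\<^esub> x \<in> {x \<in> carrier N. \<exists>e \<in> J. e \<odot> x = x}"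
    unfolding a_inv_def[symmetric] using M.a_inv_closed by blast
next
  fix x y
  assume "x \<in> {x \<in> carrier N. \<exists>e \<in> J. e \<odot> x = x}" "y \<in> {x \<in> carrier N. \<exists>e \<in> J. e \<odot> x = x}"
  then obtain e e' where x: "x \<in> carrier N" "e \<in> J" "e \<odot> x = x"
    and y: "y \<in> carrier N" "e' \<in> J" "e' \<odot> y = y"
    by blast
  define d where "d = e \<oplus>\<^bsub>R\<^esub> e' \<ominus>\<^bsub>R\<^esub> e \<otimes>\<^bsub>R\<^esub> e'"
  have e: "e \<in> carrier R" "e' \<in> carrier R"
    using x y J.Icarr by auto
  have "d \<in> J"
    unfolding d_def R.minus_eq using x(2) y(2) e
    by (intro J.a_closed J.a_inv_closed J.I_r_closed)
  moreover have expand: "d \<odot> z = (e \<odot> z \<oplus> e' \<odot> z) \<oplus> \<ominus> (e \<odot> (e' \<odot> z))" if "z \<in> carrier N" for z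
    unfolding d_def using that e
    by (simp add: R.minus_eq smult_l_distr smult_l_minus smult_assoc1)
  have "d \<odot> x = x"
  proof -
    have "e \<odot> (e' \<odot> x) = e' \<odot> x"
      using x e by (metis smult_assoc1 R.m_comm)
    then show ?thesis
      using expand[OF x(1)] x e by (simp add: M.a_assoc M.r_neg)
  qed
  moreover have "d \<odot> y = y"
    using expand[OF y(1)] y e by (simp add: M.a_ac M.r_neg M.r_neg2)
  ultimately have "d \<in> J" "d \<odot> (x \<oplus> y) = x \<oplus> y"
    using x y J.Icarr by (simp_all add: smult_r_distr)
  then show "x \<otimes>\<^bsub>add_monoid N\<^esub> y \<in> {x \<in> carrier N. \<exists>e \<in> J. e \<odot> x = x}"
    using x y by auto
qed auto

lemma fixed_imp_flat_quotient:
  fixes R :: "('a, 'x) ring_scheme"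
  assumes "cring R" and "ideal J R"
    and fixed: "\<And>a. a \<in> J \<Longrightarrow> \<exists>e \<in> J. e \<otimes>\<^bsub>R\<^esub> a = a"
  shows "flat_module TYPE('n) R (quotient_module R J)"
  unfolding flat_module_def
proof (intro conjI allI impI, goal_cases)
  case 1
  show ?case
    by (rule module_quotient_module[OF assms(1,2)])
next
  case (2 N N' f)
  then have mN: "module R N" and mN': "module R N'" and f: "f \<in> mod_hom R N N'"
    and inj: "inj_on f (carrier N)"
    by auto
  interpret N: module_with_ideal R N J
    by (rule module_with_ideal.intro[OF mN assms(2)])
  interpret N': module_with_ideal R N' J
    by (rule module_with_ideal.intro[OF mN' assms(2)])
  interpret f: group_hom "add_monoid N" "add_monoid N'" f
    using f N.M.a_group N'.M.a_group by (simp add: group_hom_def group_hom_axioms_def mod_hom_def)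
  have f_closed: "f n \<in> carrier N'" if "n \<in> carrier N" for n
    using f.hom_closed that by simp
  have f_diff: "f (n \<ominus>\<^bsub>N\<^esub> m) = f n \<ominus>\<^bsub>N'\<^esub> f m" if "n \<in> carrier N" "m \<in> carrier N" for n m
    using that f.hom_mult[of n "\<ominus>\<^bsub>N\<^esub> m"] f.hom_inv[of m]
    by (simp add: N.M.minus_eq N'.M.minus_eq a_inv_def[symmetric])
  have f_smult: "f (r \<odot>\<^bsub>N\<^esub> n) = r \<odot>\<^bsub>N'\<^esub> f n" if "r \<in> carrier R" "n \<in> carrier N" for r n
    using f that by (simp add: mod_hom_def)
  show ?case
  proof (rule inj_onI)
    fix X Y
    assume "X \<in> carrier (tensor_product R (quotient_module R J) N)"
      and "Y \<in> carrier (tensor_product R (quotient_module R J) N)"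
      and eq: "tensor_map R (quotient_module R J) N N' f X = tensor_map R (quotient_module R J) N N' f Y"
    then obtain n m where n: "n \<in> carrier N" "X = unit_tensor R J N n"
      and m: "m \<in> carrier N" "Y = unit_tensor R J N m"
      by (metis N.tensor_eq_unit_tensor)
    have eq': "unit_tensor R J N' (f n) = unit_tensor R J N' (f m)"
      using eq tensor_map_unit_tensor[OF N.module_with_ideal_axioms mN' f] n m by simp
    have "f n \<ominus>\<^bsub>N'\<^esub> f m \<in> {x \<in> carrier N'. \<exists>e \<in> J. e \<odot>\<^bsub>N'\<^esub> x = x}"
    proof (rule N'.unit_tensor_eqD[OF N'.subgroup_fixed_elements _ f_closed[OF n(1)] f_closed[OF m(1)] eq'])
      fix j y assume j: "j \<in> J" and y: "y \<in> carrier N'"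
      obtain e where "e \<in> J" "e \<otimes>\<^bsub>R\<^esub> j = j"
        using fixed[OF j] by blast
      then have "e \<odot>\<^bsub>N'\<^esub> (j \<odot>\<^bsub>N'\<^esub> y) = j \<odot>\<^bsub>N'\<^esub> y"
        using N'.smult_assoc1[of e j y] j y N.J.Icarr by simp
      then show "j \<odot>\<^bsub>N'\<^esub> y \<in> {x \<in> carrier N'. \<exists>e \<in> J. e \<odot>\<^bsub>N'\<^esub> x = x}"
        using \<open>e \<in> J\<close> j y N.J.Icarr by auto
    qed
    then obtain e where e: "e \<in> J" "e \<odot>\<^bsub>N'\<^esub> (f n \<ominus>\<^bsub>N'\<^esub> f m) = f n \<ominus>\<^bsub>N'\<^esub> f m"
      by blast
    have d: "n \<ominus>\<^bsub>N\<^esub> m \<in> carrier N"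
      using n m by simp
    have "f (e \<odot>\<^bsub>N\<^esub> (n \<ominus>\<^bsub>N\<^esub> m)) = f (n \<ominus>\<^bsub>N\<^esub> m)"
      using e f_smult[OF N.J.Icarr[OF e(1)] d] f_diff n m by simp
    then have "e \<odot>\<^bsub>N\<^esub> (n \<ominus>\<^bsub>N\<^esub> m) = n \<ominus>\<^bsub>N\<^esub> m"
      using inj_onD[OF inj] d N.J.Icarr[OF e(1)] by simp
    moreover have "m \<oplus>\<^bsub>N\<^esub> (n \<ominus>\<^bsub>N\<^esub> m) = n"
      using n m N.M.a_comm[OF m(1) d] by (simp add: N.M.minus_eq N.M.a_assoc N.M.l_neg)
    ultimately show "X = Y"
      using N.unit_tensor_add_smult[OF m(1) e(1) d] n m by simp
  qed
qed

lemma annihilator_plus_ideal_eq_iff: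
  assumes "cring R" and "ideal J R" and a: "a \<in> J"
  shows "annihilator R a <+>\<^bsub>R\<^esub> J = carrier R \<longleftrightarrow> (\<exists>e \<in> J. e \<otimes>\<^bsub>R\<^esub> a = a)"
proof -
  interpret cring R by fact
  interpret J: ideal J R by fact
  have aR: "a \<in> carrier R"
    using a by (rule J.Icarr)
  show ?thesis
  proof
    assume "annihilator R a <+>\<^bsub>R\<^esub> J = carrier R"
    then have "\<one>\<^bsub>R\<^esub> \<in> annihilator R a <+>\<^bsub>R\<^esub> J"
      by simp
    then obtain s e where s: "s \<in> carrier R" "s \<otimes>\<^bsub>R\<^esub> a = \<zero>\<^bsub>R\<^esub>" and e: "e \<in> J"
      and one: "\<one>\<^bsub>R\<^esub> = s \<oplus>\<^bsub>R\<^esub> e"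
      by (auto simp: set_add_defs annihilator_def)
    have "a = (s \<oplus>\<^bsub>R\<^esub> e) \<otimes>\<^bsub>R\<^esub> a"
      using aR by (simp flip: one)
    also have "\<dots> = e \<otimes>\<^bsub>R\<^esub> a"
      using s e aR J.Icarr by (simp add: l_distr)
    finally show "\<exists>e \<in> J. e \<otimes>\<^bsub>R\<^esub> a = a"
      using e by metis
  next
    assume "\<exists>e \<in> J. e \<otimes>\<^bsub>R\<^esub> a = a"
    then obtain e where e: "e \<in> J" "e \<otimes>\<^bsub>R\<^esub> a = a"
      by blast
    have eR: "e \<in> carrier R"
      using e J.Icarr by simp
    show "annihilator R a <+>\<^bsub>R\<^esub> J = carrier R"
    proof
      show "annihilator R a <+>\<^bsub>R\<^esub> J \<subseteq> carrier R"
        by (auto simp: set_add_defs annihilator_def J.Icarr)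
      show "carrier R \<subseteq> annihilator R a <+>\<^bsub>R\<^esub> J"
      proof
        fix r assume r: "r \<in> carrier R"
        have "(r \<ominus>\<^bsub>R\<^esub> r \<otimes>\<^bsub>R\<^esub> e) \<otimes>\<^bsub>R\<^esub> a = r \<otimes>\<^bsub>R\<^esub> a \<ominus>\<^bsub>R\<^esub> r \<otimes>\<^bsub>R\<^esub> (e \<otimes>\<^bsub>R\<^esub> a)"
          using r eR aR by algebra
        also have "\<dots> = \<zero>\<^bsub>R\<^esub>"
          using e r aR by (simp add: minus_eq r_neg)
        finally have "r \<ominus>\<^bsub>R\<^esub> r \<otimes>\<^bsub>R\<^esub> e \<in> annihilator R a"
          using r eR by (simp add: annihilator_def)
        moreover have "r \<otimes>\<^bsub>R\<^esub> e \<in> J"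
          using J.I_l_closed e r by simp
        moreover have "r = (r \<ominus>\<^bsub>R\<^esub> r \<otimes>\<^bsub>R\<^esub> e) \<oplus>\<^bsub>R\<^esub> r \<otimes>\<^bsub>R\<^esub> e"
          using r eR by algebra
        ultimately show "r \<in> annihilator R a <+>\<^bsub>R\<^esub> J"
          unfolding set_add_defs by auto
      qed
    qed
  qed
qed

theorem corollary3p4:
  fixes R :: "('a, 'x) ring_scheme" and J :: "'a set"
  assumes "cring R"
    and "ideal J R"
    and universe: "carrier R \<lesssim> (UNIV :: 'n set)"
  shows "flat_module TYPE('n) R (quotient_module R J) \<longleftrightarrow>
    (\<forall>a \<in> J. annihilator R a <+>\<^bsub>R\<^esub> J = carrier R)"
proof -
  obtain \<phi> :: "'a \<Rightarrow> 'n" where inj: "inj_on \<phi> (carrier R)"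
    using universe unfolding lepoll_def by blast
  have "flat_module TYPE('n) R (quotient_module R J) \<longleftrightarrow> (\<forall>a \<in> J. \<exists>e \<in> J. e \<otimes>\<^bsub>R\<^esub> a = a)"
    using flat_quotient_imp_fixed[OF assms(1,2) inj] fixed_imp_flat_quotient[OF assms(1,2)]
    by metis
  then show ?thesis
    using annihilator_plus_ideal_eq_iff[OF assms(1,2)] by simp
qed

end
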